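(* Let $f$ be an order preserving bijective transformation of the vertex set of the infinite Johnson graph $J_{\infty}$. Then $f$ is the automorphism of $J_{\infty}$ induced by a permutation of $\mathbb{N}$, i.e. there exists a permutation $s$ of $\mathbb{N}$ such that $f(X)=s(X)$ for every vertex $X$ of $J_{\infty}$.
   Context: The infinite Johnson graph $J_{\infty}$ is the simple graph whose vertices are all subsets $X\subset\mathbb{N}$ with $|X|=|\mathbb{N}\setminus X|=\infty$; two vertices $X,Y$ are adjacent if $|X\setminus Y|=|Y\setminus X|=1$. A bijective transformation $f$ of the vertex set (a bijection of the vertex set onto itself) is called order preserving if for all vertices $X,Y$ one has $X\subset Y\Leftrightarrow f(X)\subset f(Y)$, where $\subset$ is (non-strict) inclusion. For a permutation $s$ of $\mathbb{N}$, $s(X)=\{s(x):x\in X\}$; the map $X\mapsto s(X)$ is the automorphism of $J_{\infty}$ induced by $s$. *)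

theory Defs
  imports Main
begin

definition johnson_vertices :: "nat set set" where
  "johnson_vertices = {X. infinite X \<and> infinite (UNIV - X)}"

definition johnson_adj :: "nat set \<Rightarrow> nat set \<Rightarrow> bool" where
  "johnson_adj X Y \<longleftrightarrow>
     X \<in> johnson_vertices \<and> Y \<in> johnson_vertices \<and> card (X - Y) = 1 \<and> card (Y - X) = 1"

text \<open>
  A transformation of the vertex set is a function on all sets of natural numbers;
  only its values on vertices are ever constrained.
\<close>

definition johnson_automorphism :: "(nat set \<Rightarrow> nat set) \<Rightarrow> bool" where
  "johnson_automorphism f \<longleftrightarrow>
     bij_betw f johnson_vertices johnson_vertices \<and>
     (\<forall>X\<in>johnson_vertices. \<forall>Y\<in>johnson_vertices. johnson_adj X Y \<longleftrightarrow> johnson_adj (f X) (f Y))"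

definition order_preserving :: "(nat set \<Rightarrow> nat set) \<Rightarrow> bool" where
  "order_preserving f \<longleftrightarrow>
     (\<forall>X\<in>johnson_vertices. \<forall>Y\<in>johnson_vertices. X \<subseteq> Y \<longleftrightarrow> f X \<subseteq> f Y)"

definition induced_by :: "(nat set \<Rightarrow> nat set) \<Rightarrow> (nat \<Rightarrow> nat) \<Rightarrow> bool" where
  "induced_by f s \<longleftrightarrow> (\<forall>X\<in>johnson_vertices. f X = s ` X)"

end

theory Submission
  imports Defs
begin

text \<open>
  A vertex \<open>Y \<supseteq> X\<close> with just one more point than \<open>X\<close> is an upper
  cover of \<open>X\<close> in the inclusion order, because no vertex fits strictly in between; dually for
  deleting a point. An order preserving bijection \<open>f\<close> respects covers, so at each vertex \<open>X\<close> it
  determines a point map: adding a point \<open>x \<notin> X\<close> adds a single point to \<open>f X\<close>, and removing a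
  point \<open>x \<in> X\<close> removes a single point from \<open>f X\<close>. Since the inverse of \<open>f\<close> respects covers
  too, this point map is a permutation of the natural numbers (\<open>bij_point_map\<close>), and by
  construction it carries \<open>X\<close> into \<open>f X\<close> and the complement of \<open>X\<close> into the complement of \<open>f X\<close>.
  A permutation that does so carries \<open>X\<close> onto \<open>f X\<close>.

  The remaining question is whether all vertices have the same point map. They agree at
  comparable vertices (\<open>point_map_mono_eq\<close>): otherwise \<open>f\<close> would create an inclusion between two
  sets that are not nested. Any two vertices are joined by a chain of comparable ones
  (\<open>vertices_connected_by_inclusion\<close>), so one permutation serves for all of them. A map
  induced by a permutation respects cardinalities of differences, hence adjacency.
\<close>

section \<open>Vertices\<close>

lemma insert_vertex: "X \<in> johnson_vertices \<Longrightarrow> insert x X \<in> johnson_vertices"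
  unfolding johnson_vertices_def by (simp add: Diff_insert[of UNIV x X])

lemma remove_vertex: "X \<in> johnson_vertices \<Longrightarrow> X - {x} \<in> johnson_vertices"
proof -
  have "UNIV - (X - {x}) \<supseteq> UNIV - X" by blast
  then show "X \<in> johnson_vertices \<Longrightarrow> X - {x} \<in> johnson_vertices"
    unfolding johnson_vertices_def by (auto dest: finite_subset)
qed

lemma infinite_split:
  assumes "infinite X"
  obtains A where "A \<subseteq> X" "infinite A" "infinite (X - A)"
proof -
  obtain e :: "nat \<Rightarrow> 'a" where e: "inj e" "range e \<subseteq> X"
    using infinite_countable_subset[OF assms] by blast
  define A where "A = range (\<lambda>n. e (2 * n))"
  define B where "B = range (\<lambda>n. e (2 * n + 1))"
  have "inj (\<lambda>n. e (2 * n))" "inj (\<lambda>n. e (2 * n + 1))"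
    by (auto intro!: injI simp: inj_eq[OF e(1)])
  then have "infinite A" "infinite B"
    unfolding A_def B_def by (auto dest!: finite_imageD)
  moreover have "2 * m + 1 \<noteq> 2 * n" for m n :: nat by presburger
  then have "B \<subseteq> X - A"
    using e unfolding A_def B_def by (fastforce simp: inj_eq)
  ultimately have "infinite (X - A)" using finite_subset by blast
  moreover have "A \<subseteq> X" using e(2) unfolding A_def by blast
  ultimately show thesis using that \<open>infinite A\<close> by blast
qed

text \<open>
  If \<open>X \<inter> Y\<close> is infinite, it lies below both vertices. If it is finite, half of \<open>X\<close> is a vertex
  \<open>A\<close>, and the other half is almost disjoint from \<open>Y\<close>, so it keeps \<open>A \<union> Y\<close> coinfinite even when
  \<open>X \<union> Y\<close> is everything.
\<close>

lemma vertices_connected_by_inclusion: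
  assumes X: "X \<in> johnson_vertices" and Y: "Y \<in> johnson_vertices"
  obtains A B where "A \<in> johnson_vertices" "B \<in> johnson_vertices"
    "A \<subseteq> X" "A \<subseteq> B" "Y \<subseteq> B"
    | A where "A \<in> johnson_vertices" "A \<subseteq> X" "A \<subseteq> Y"
proof (cases "finite (X \<inter> Y)")
  case False
  then have "X \<inter> Y \<in> johnson_vertices"
    using X by (auto simp: johnson_vertices_def Diff_Int)
  then show thesis using that(2) by blast
next
  case True
  from X obtain A where A: "A \<subseteq> X" "infinite A" "infinite (X - A)"
    using infinite_split unfolding johnson_vertices_def by auto
  have "X - A \<subseteq> (UNIV - (A \<union> Y)) \<union> (X \<inter> Y)" by blast
  with A(3) True have co: "infinite (UNIV - (A \<union> Y))"
    by (meson finite_UnI finite_subset)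
  have "A \<in> johnson_vertices"
    using A(2) co finite_subset[of "UNIV - (A \<union> Y)" "UNIV - A"]
    by (auto simp: johnson_vertices_def)
  moreover have "A \<union> Y \<in> johnson_vertices"
    using A(2) co by (simp add: johnson_vertices_def)
  ultimately show thesis using that(1) A(1) by blast
qed

section \<open>The point map at a vertex\<close>

locale johnson_order_automorphism =
  fixes f :: "nat set \<Rightarrow> nat set"
  assumes bij: "bij_betw f johnson_vertices johnson_vertices"
    and order: "order_preserving f"
begin

lemma vertex: "X \<in> johnson_vertices \<Longrightarrow> f X \<in> johnson_vertices"
  using bij by (rule bij_betwE[rule_format])

lemma subset_iff:
  "X \<in> johnson_vertices \<Longrightarrow> Y \<in> johnson_vertices \<Longrightarrow> f X \<subseteq> f Y \<longleftrightarrow> X \<subseteq> Y"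
  using order unfolding order_preserving_def by simp

lemma onto:
  assumes "Z \<in> johnson_vertices"
  obtains X where "X \<in> johnson_vertices" "f X = Z"
proof -
  have "Z \<in> f ` johnson_vertices" using assms bij_betw_imp_surj_on[OF bij] by simp
  then show thesis using that by (auto elim: imageE)
qed

lemma inverse: "johnson_order_automorphism (inv_into johnson_vertices f)"
proof
  show "bij_betw (inv_into johnson_vertices f) johnson_vertices johnson_vertices"
    using bij by (rule bij_betw_inv_into)
  show "order_preserving (inv_into johnson_vertices f)"
    unfolding order_preserving_def
  proof (intro ballI)
    fix X Y assume "X \<in> johnson_vertices" "Y \<in> johnson_vertices"
    then obtain X' Y' where "X' \<in> johnson_vertices" "f X' = X" "Y' \<in> johnson_vertices" "f Y' = Y"
      by (meson onto)
    then show "X \<subseteq> Y \<longleftrightarrow>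
        inv_into johnson_vertices f X \<subseteq> inv_into johnson_vertices f Y"
      using subset_iff bij_betw_inv_into_left[OF bij] by metis
  qed
qed

text \<open>
  Some \<open>y\<close> is gained in passing from \<open>f X\<close> to \<open>f (insert x X)\<close>. By surjectivity \<open>insert y (f X)\<close>
  is itself the image of a vertex, which must lie strictly above \<open>X\<close> and not beyond
  \<open>insert x X\<close>; there is only one such set.
\<close>

lemma insert_image:
  assumes X: "X \<in> johnson_vertices" and x: "x \<notin> X"
  obtains y where "y \<notin> f X" "f (insert x X) = insert y (f X)"
proof -
  let ?X' = "insert x X"
  have X': "?X' \<in> johnson_vertices" using X by (rule insert_vertex)
  have sub: "f X \<subseteq> f ?X'" and "\<not> f ?X' \<subseteq> f X"
    using subset_iff X X' x by auto
  then obtain y where y: "y \<in> f ?X'" "y \<notin> f X" by blast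
  obtain Z where Z: "Z \<in> johnson_vertices" "f Z = insert y (f X)"
    using onto insert_vertex vertex X by metis
  have "X \<subseteq> Z" "\<not> Z \<subseteq> X" "Z \<subseteq> ?X'"
    using subset_iff[of X Z] subset_iff[of Z X] subset_iff[of Z ?X'] X X' Z y sub by auto
  then have "Z = ?X'" by blast
  then show thesis using that y Z by blast
qed

lemma remove_image:
  assumes X: "X \<in> johnson_vertices" and x: "x \<in> X"
  obtains y where "y \<in> f X" "f (X - {x}) = f X - {y}"
proof -
  let ?X' = "X - {x}"
  have X': "?X' \<in> johnson_vertices" using X by (rule remove_vertex)
  have sub: "f ?X' \<subseteq> f X" and "\<not> f X \<subseteq> f ?X'"
    using subset_iff X X' x by auto
  then obtain y where y: "y \<in> f X" "y \<notin> f ?X'" by blast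
  obtain Z where Z: "Z \<in> johnson_vertices" "f Z = f X - {y}"
    using onto remove_vertex vertex X by metis
  have "Z \<subseteq> X" "\<not> X \<subseteq> Z" "?X' \<subseteq> Z"
    using subset_iff[of X Z] subset_iff[of Z X] subset_iff[of ?X' Z] X X' Z y sub by auto
  then have "Z = ?X'" by blast
  then show thesis using that y Z by blast
qed

text \<open>
  Both differences are singletons whenever \<open>X\<close> is a vertex: the point that \<open>f X\<close> loses when
  \<open>x\<close> leaves \<open>X\<close>, or gains when \<open>x\<close> enters.
\<close>

definition point_map :: "nat set \<Rightarrow> nat \<Rightarrow> nat" where
  "point_map X x =
     (if x \<in> X then the_elem (f X - f (X - {x})) else the_elem (f (insert x X) - f X))"

lemma point_map_outside:
  assumes "X \<in> johnson_vertices" "x \<notin> X"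
  shows "point_map X x \<notin> f X" "f (insert x X) = insert (point_map X x) (f X)"
proof -
  obtain y where y: "y \<notin> f X" "f (insert x X) = insert y (f X)"
    using insert_image assms by blast
  then have "f (insert x X) - f X = {y}" by auto
  then have "point_map X x = y" using assms by (simp add: point_map_def)
  with y show "point_map X x \<notin> f X" "f (insert x X) = insert (point_map X x) (f X)" by auto
qed

lemma point_map_inside:
  assumes "X \<in> johnson_vertices" "x \<in> X"
  shows "point_map X x \<in> f X" "f (X - {x}) = f X - {point_map X x}"
proof -
  obtain y where y: "y \<in> f X" "f (X - {x}) = f X - {y}"
    using remove_image assms by blast
  then have "f X - f (X - {x}) = {y}" by auto
  then have "point_map X x = y" using assms by (simp add: point_map_def)
  with y show "point_map X x \<in> f X" "f (X - {x}) = f X - {point_map X x}" by auto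
qed

lemma inj_vertices:
  "X \<in> johnson_vertices \<Longrightarrow> Y \<in> johnson_vertices \<Longrightarrow> f X = f Y \<Longrightarrow> X = Y"
  using bij by (auto simp: bij_betw_def dest: inj_onD)

lemma inj_point_map:
  assumes X: "X \<in> johnson_vertices"
  shows "inj (point_map X)"
proof (rule injI)
  fix x y assume eq: "point_map X x = point_map X y"
  consider "x \<in> X" "y \<in> X" | "x \<notin> X" "y \<notin> X"
    using point_map_inside(1)[OF X] point_map_outside(1)[OF X] eq by metis
  then show "x = y"
  proof cases
    case 1
    then have "X - {x} = X - {y}"
      using point_map_inside(2)[OF X] eq inj_vertices remove_vertex[OF X] by metis
    with 1 show ?thesis by blast
  next
    case 2
    then have "insert x X = insert y X"
      using point_map_outside(2)[OF X] eq inj_vertices insert_vertex[OF X] by metis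
    with 2 show ?thesis by blast
  qed
qed

lemma surj_point_map:
  assumes X: "X \<in> johnson_vertices"
  shows "surj (point_map X)"
proof -
  let ?g = "inv_into johnson_vertices f"
  interpret g: johnson_order_automorphism ?g by (rule inverse)
  have gf: "?g (f X) = X" using bij X by (simp add: bij_betw_inv_into_left)
  have fg: "f (?g Z) = Z" if "Z \<in> johnson_vertices" for Z
    using bij that by (rule bij_betw_inv_into_right)
  have "\<exists>x. point_map X x = y" for y
  proof (cases "y \<in> f X")
    case True
    obtain x where x: "x \<in> X" "?g (f X - {y}) = X - {x}"
      using g.remove_image[OF vertex[OF X] True] gf by metis
    then have "f (X - {x}) = f X - {y}"
      using fg remove_vertex vertex X by metis
    then have "f X - {point_map X x} = f X - {y}"
      using point_map_inside X x by metis
    then show ?thesis using True point_map_inside(1)[OF X x(1)] by blast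
  next
    case False
    obtain x where x: "x \<notin> X" "?g (insert y (f X)) = insert x X"
      using g.insert_image[OF vertex[OF X] False] gf by metis
    then have "f (insert x X) = insert y (f X)"
      using fg insert_vertex vertex X by metis
    then have "insert (point_map X x) (f X) = insert y (f X)"
      using point_map_outside X x by metis
    then show ?thesis using False point_map_outside(1)[OF X x(1)] by blast
  qed
  then show ?thesis by (metis surjI)
qed

lemma bij_point_map: "X \<in> johnson_vertices \<Longrightarrow> bij (point_map X)"
  by (simp add: bij_def inj_point_map surj_point_map)

text \<open>
  The point map sends points outside \<open>X\<close> to points outside \<open>f X\<close>, so by surjectivity every
  point of \<open>f X\<close> comes from \<open>X\<close>.
\<close>

lemma point_map_image:
  assumes X: "X \<in> johnson_vertices"
  shows "point_map X ` X = f X"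
proof
  show "point_map X ` X \<subseteq> f X" using point_map_inside(1)[OF X] by blast
  show "f X \<subseteq> point_map X ` X"
  proof
    fix y assume "y \<in> f X"
    moreover obtain x where "y = point_map X x" using surj_point_map[OF X] by blast
    ultimately show "y \<in> point_map X ` X" using point_map_outside(1)[OF X, of x] by blast
  qed
qed

section \<open>Independence of the vertex\<close>

text \<open>
  Each case plays an inclusion off against a failure of inclusion that \<open>f\<close> must reflect.
  For instance, when \<open>x\<close> lies outside \<open>Y\<close>, the sets with \<open>x\<close> added are nested, so the new point
  over \<open>X\<close> is either the new point over \<open>Y\<close> or already in \<open>f Y\<close>; the latter would force
  \<open>x\<close> into \<open>Y\<close>.
\<close>

lemma point_map_mono_eq:
  assumes X: "X \<in> johnson_vertices" and Y: "Y \<in> johnson_vertices" and sub: "X \<subseteq> Y"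
  shows "point_map X = point_map Y"
proof
  fix x
  have XY: "f X \<subseteq> f Y" using subset_iff X Y sub by blast
  consider (out) "x \<notin> Y" | (inn) "x \<in> X" | (mid) "x \<in> Y" "x \<notin> X" by blast
  then show "point_map X x = point_map Y x"
  proof cases
    case out
    then have x: "x \<notin> X" using sub by blast
    have "f (insert x X) \<subseteq> f (insert x Y)"
      using subset_iff insert_vertex X Y sub by (meson insert_mono)
    moreover have "\<not> f (insert x X) \<subseteq> f Y"
      using subset_iff[OF insert_vertex[OF X] Y] out by blast
    ultimately show ?thesis
      using XY by (simp add: point_map_outside(2)[OF X x] point_map_outside(2)[OF Y out])
  next
    case inn
    then have x: "x \<in> Y" using sub by blast
    have "f (X - {x}) \<subseteq> f (Y - {x})"
      using subset_iff[OF remove_vertex[OF X] remove_vertex[OF Y]] sub by blast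
    moreover have "\<not> f X \<subseteq> f (Y - {x})"
      using subset_iff[OF X remove_vertex[OF Y]] inn by blast
    ultimately show ?thesis
      using XY point_map_inside[OF X inn] point_map_inside[OF Y x] by blast
  next
    case mid
    have "f X \<subseteq> f (Y - {x})"
      using subset_iff[OF X remove_vertex[OF Y]] sub mid by blast
    moreover have "\<not> f (insert x X) \<subseteq> f (Y - {x})"
      using subset_iff[OF insert_vertex[OF X] remove_vertex[OF Y]] by blast
    moreover have "f (insert x X) \<subseteq> f Y"
      using subset_iff[OF insert_vertex[OF X] Y] sub mid by blast
    ultimately show ?thesis
      by (auto simp: point_map_outside(2)[OF X mid(2)] point_map_inside(2)[OF Y mid(1)])
  qed
qed

lemma point_map_eq:
  assumes X: "X \<in> johnson_vertices" and Y: "Y \<in> johnson_vertices"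
  shows "point_map X = point_map Y"
proof (rule vertices_connected_by_inclusion[OF X Y])
  fix A B
  assume "A \<in> johnson_vertices" "B \<in> johnson_vertices" "A \<subseteq> X" "A \<subseteq> B" "Y \<subseteq> B"
  then have "point_map A = point_map X" "point_map A = point_map B" "point_map Y = point_map B"
    using X Y by (auto intro: point_map_mono_eq)
  then show ?thesis by simp
next
  fix A
  assume "A \<in> johnson_vertices" "A \<subseteq> X" "A \<subseteq> Y"
  then have "point_map A = point_map X" "point_map A = point_map Y"
    using X Y by (auto intro: point_map_mono_eq)
  then show ?thesis by simp
qed

lemma induced_by_permutation: "\<exists>s. bij s \<and> induced_by f s"
proof -
  have "infinite (UNIV :: nat set)" by simp
  then obtain V :: "nat set" where "infinite V" "infinite (UNIV - V)"
    by (rule infinite_split)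
  then have V: "V \<in> johnson_vertices" by (simp add: johnson_vertices_def)
  have "f X = point_map V ` X" if "X \<in> johnson_vertices" for X
    using point_map_image[OF that] point_map_eq[OF that V] by simp
  then show ?thesis using bij_point_map[OF V] unfolding induced_by_def by blast
qed

end

section \<open>Order preserving bijections are induced by permutations\<close>

lemma induced_by_adj_iff:
  assumes "inj s" "induced_by f s" "bij_betw f johnson_vertices johnson_vertices"
    and X: "X \<in> johnson_vertices" and Y: "Y \<in> johnson_vertices"
  shows "johnson_adj (f X) (f Y) \<longleftrightarrow> johnson_adj X Y"
proof -
  have "f X \<in> johnson_vertices" "f Y \<in> johnson_vertices"
    using assms bij_betwE by blast+
  moreover have "f X = s ` X" "f Y = s ` Y"
    using assms unfolding induced_by_def by auto
  moreover have "card (s ` A - s ` B) = card (A - B)" for A B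
    using \<open>inj s\<close> by (metis image_set_diff card_image inj_on_subset subset_UNIV)
  ultimately show ?thesis using X Y by (simp add: johnson_adj_def)
qed

theorem theorem2:
  fixes f :: "nat set \<Rightarrow> nat set"
  assumes "bij_betw f johnson_vertices johnson_vertices"
    and "order_preserving f"
  shows "johnson_automorphism f \<and> (\<exists>s :: nat \<Rightarrow> nat. bij s \<and> induced_by f s)"
proof -
  interpret johnson_order_automorphism f by standard (use assms in auto)
  obtain s where s: "bij s" "induced_by f s" using induced_by_permutation by blast
  then have "johnson_automorphism f"
    unfolding johnson_automorphism_def
    using assms(1) induced_by_adj_iff[of s f] by (simp add: bij_is_inj)
  with s show ?thesis by blast
qed

end
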